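(* Let $L_k(x)$ denote the Lucas polynomials, defined by $L_0(x)=2$, $L_1(x)=x$, and $L_k(x)=xL_{k-1}(x)+L_{k-2}(x)$ for $k\ge2$. Then for every complex number $x$ for which the denominator below is nonzero, $$e^x=\dfrac{\displaystyle\sum_{k=0}^\infty\frac{L_k(x)}{k!}}{\displaystyle\sum_{k=0}^\infty(-1)^{k}\frac{L_k(x)}{k!}}.$$
   Context: The Lucas polynomials satisfy $L_k(x)=\left(\frac{x+\sqrt{x^2+4}}{2}\right)^k+\left(\frac{x-\sqrt{x^2+4}}{2}\right)^k$. *)

theory Defs
  imports Complex_Main "HOL-Computational_Algebra.Polynomial"
begin

fun lucas_poly :: "nat \<Rightarrow> 'a::comm_ring_1 poly" where
  "lucas_poly 0 = [:2:]"
| "lucas_poly (Suc 0) = [:0, 1:]"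
| "lucas_poly (Suc (Suc k)) = [:0, 1:] * lucas_poly (Suc k) + lucas_poly k"

end

theory Submission
  imports Defs
begin

text \<open>
  Let \<open>a\<close>, \<open>b\<close> be the roots of \<open>t\<^sup>2 - x t - 1\<close>, so that \<open>a + b = x\<close>, \<open>a b = - 1\<close> and
  \<open>L\<^sub>k(x) = a\<^sup>k + b\<^sup>k\<close>. The numerator is then \<open>e\<^sup>a + e\<^sup>b\<close>, and the denominator is
  \<open>e\<^bsup>-a\<^esup> + e\<^bsup>-b\<^esup> = (e\<^sup>a + e\<^sup>b) / e\<^bsup>a+b\<^esup>\<close>.
\<close>

lemma poly_lucas_poly_add:
  fixes a b :: "'a::comm_ring_1"
  assumes "a * b = - 1"
  shows "poly (lucas_poly k) (a + b) = a ^ k + b ^ k"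
proof (induction k rule: lucas_poly.induct)
  case (3 k)
  \<comment> \<open>The cross terms of the product collect to
    \<open>a * b * (a ^ k + b ^ k)\<close>, so the recurrence leaves an error with factor
    \<open>a * b + 1\<close>, which is zero.\<close>
  have "(a + b) * (a ^ Suc k + b ^ Suc k) + (a ^ k + b ^ k) =
        a ^ Suc (Suc k) + b ^ Suc (Suc k) + (a * b + 1) * (a ^ k + b ^ k)"
    by (simp add: algebra_simps)
  with 3 assms show ?case by simp
qed simp_all

text \<open>The factor \<open>c\<close> treats both series at once: \<open>c = 1\<close> gives the
  numerator and \<open>c = - 1\<close> the denominator.\<close>

lemma lucas_poly_exp_sums:
  fixes a b :: "'a::{real_normed_field,banach}"
  assumes "a * b = - 1"
  shows "(\<lambda>k. c ^ k * (poly (lucas_poly k) (a + b) / fact k)) sums (exp (c * a) + exp (c * b))"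
proof -
  have "(\<lambda>k. (c * a) ^ k /\<^sub>R fact k + (c * b) ^ k /\<^sub>R fact k) sums (exp (c * a) + exp (c * b))"
    by (intro sums_add exp_converges)
  then show ?thesis
    by (simp add: poly_lucas_poly_add[OF assms] scaleR_conv_of_real field_simps power_mult_distrib)
qed

theorem theorem4:
  fixes x :: complex
  shows "summable (\<lambda>k. poly (lucas_poly k) x / fact k) \<and>
         summable (\<lambda>k. (- 1) ^ k * (poly (lucas_poly k) x / fact k)) \<and>
         ((\<Sum>k. (- 1) ^ k * (poly (lucas_poly k) x / fact k)) \<noteq> 0 \<longrightarrow>
           exp x = (\<Sum>k. poly (lucas_poly k) x / fact k) /
                   (\<Sum>k. (- 1) ^ k * (poly (lucas_poly k) x / fact k)))"
proof -
  define s where "s = csqrt (x\<^sup>2 + 4)"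
  define a where "a = (x + s) / 2"
  define b where "b = (x - s) / 2"
  have x: "a + b = x"
    by (simp add: a_def b_def field_simps)
  have "a * b = (x\<^sup>2 - s\<^sup>2) / 4"
    by (simp add: a_def b_def field_simps power2_eq_square)
  then have ab: "a * b = - 1"
    by (simp add: s_def)
  have num: "(\<lambda>k. poly (lucas_poly k) x / fact k) sums (exp a + exp b)"
    using lucas_poly_exp_sums[OF ab, of 1] by (simp add: x)
  have den: "(\<lambda>k. (- 1) ^ k * (poly (lucas_poly k) x / fact k)) sums (exp (- a) + exp (- b))"
    using lucas_poly_exp_sums[OF ab, of "- 1"] by (simp add: x)
  \<comment> \<open>Since \<open>x - a = b\<close> and \<open>x - b = a\<close>, multiplying by
    \<open>exp x\<close> swaps the two exponentials.\<close>
  have "exp x * (exp (- a) + exp (- b)) = exp a + exp b"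
    by (simp add: distrib_left flip: x exp_add)
  with num den show ?thesis
    by (auto simp: sums_iff field_simps)
qed

end
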